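(* Let $d\ge 1$ and $n\ge 1$ be integers. Then $$\frac{\{(d+1)n-d\}}{\{n\}}\left\{{2(n-1):d\atop n-1:d}\right\}$$ is in $\mathbb{N}[s,t]$.
   Context: Let $s,t$ be indeterminates and $\mathbb{N}=\{0,1,2,\dots\}$. The Lucas sequence is $\{0\}=0$, $\{1\}=1$, $\{n\}=s\{n-1\}+t\{n-2\}$ for $n\ge 2$. The $d$-divisible Lucastorial is $\{n:d\}!=\{d\}\{2d\}\cdots\{nd\}$, with $\{0:d\}!=1$, and for $0\le k\le n$ the $d$-divisible Lucasnomial is $\left\{{n:d\atop k:d}\right\}=\frac{\{n:d\}!}{\{k:d\}!\,\{n-k:d\}!}$. *)

theory Defs
  imports "HOL-Computational_Algebra.Polynomial_Factorial"
begin

text \<open>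
  The ring of integer polynomials in \<open>s\<close> and \<open>t\<close> is represented as \<^typ>\<open>int poly poly\<close>, with \<open>s\<close> the
  variable of the inner and \<open>t\<close> the variable of the outer polynomial ring. Quotients are
  formed in its fraction field \<^typ>\<open>int poly poly fract\<close>.
\<close>

definition var_s :: "int poly poly" where
  "var_s = [:monom 1 1:]"

definition var_t :: "int poly poly" where
  "var_t = monom 1 1"

fun lucas :: "nat \<Rightarrow> int poly poly" where
  "lucas 0 = 0"
| "lucas (Suc 0) = 1"
| "lucas (Suc (Suc n)) = var_s * lucas (Suc n) + var_t * lucas n"

definition lucastorial :: "nat \<Rightarrow> nat \<Rightarrow> int poly poly" where
  "lucastorial d n = (\<Prod>i=1..n. lucas (i * d))"

text \<open>Only meaningful for \<open>k \<le> n\<close> and \<open>d \<ge> 1\<close>; the denominator is then nonzero by \<open>lucastorial_nonzero\<close>.\<close>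

definition lucasnomial :: "nat \<Rightarrow> nat \<Rightarrow> nat \<Rightarrow> int poly poly fract" where
  "lucasnomial d n k =
     to_fract (lucastorial d n) / (to_fract (lucastorial d k) * to_fract (lucastorial d (n - k)))"

text \<open>The semiring of polynomials in \<open>s\<close> and \<open>t\<close> with natural number coefficients, as a subset of the
  fraction field.\<close>

definition nat_polys :: "int poly poly fract set" where
  "nat_polys = {to_fract p | p. \<forall>i j. coeff (coeff p i) j \<ge> 0}"

lemma lucas_nonzero:
  assumes "n \<ge> 1"
  shows "lucas n \<noteq> 0"
proof -
  have *: "coeff (coeff (lucas (Suc m)) 0) m = 1" for m
  proof (induction m rule: less_induct)
    case (less m)
    show ?case
    proof (cases m)
      case 0
      then show ?thesis by simp
    next
      case (Suc k)
      have "coeff (coeff (lucas (Suc k)) 0) k = 1" using less Suc by simp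
      then show ?thesis
        using Suc by (simp add: var_s_def var_t_def coeff_mult_0 coeff_monom_mult)
    qed
  qed
  obtain m where "n = Suc m" using assms by (cases n) auto
  then show ?thesis using *[of m] by auto
qed

lemma lucastorial_nonzero: "d \<ge> 1 \<Longrightarrow> lucastorial d n \<noteq> 0"
  by (auto simp: lucastorial_def intro!: lucas_nonzero)

end

theory Submission
  imports Defs
begin

text \<open>
  Put \<open>m = n - 1\<close>, so that the index \<open>(d + 1) n - d\<close> is \<open>n + d m\<close>. The addition formula
  \<open>{a + b} = {a + 1}{b} + t {a}{b - 1}\<close> (\<open>lucas_add\<close>) gives
  \<open>{n + d m} = {n}{d m + 1} + t {m}{d m}\<close>, hence the quantity in question equals
  \[ \{dm+1\} {2m:d \choose m:d} + t\,\{m\}\,\frac{\{dm\}}{\{n\}} {2m:d \choose m:d}. \]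
  where the binomial symbol stands for the Lucasnomial. Only the second summand still has a
  denominator, and it vanishes for \<open>m = 0\<close>. For \<open>m \<ge> 1\<close>, moving one factor between the two
  Lucastorials in the denominator of the Lucasnomial changes \<open>{d m}\<close> into \<open>{d n}\<close>:
  \[ \{dm\} {2m:d \choose m:d} = \{dn\} {2m:d \choose m-1:d}, \]
  and \<open>{n}\<close> divides \<open>{d n}\<close>. The result is a polynomial with coefficients in \<open>\<nat>\<close>, because the
  \<open>d\<close>-divisible Lucasnomials (\<open>lucastorial_add_eq\<close>) and the quotients \<open>{d n} / {n}\<close>
  (\<open>lucas_mult_eq\<close>) are such polynomials. Both facts follow by induction: dividing suitable
  instances of the addition formula gives subtraction-free recurrences.
\<close>

definition nonneg_coeffs :: "int poly poly \<Rightarrow> bool" where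
  "nonneg_coeffs p \<longleftrightarrow> (\<forall>i j. coeff (coeff p i) j \<ge> 0)"

lemma nonneg_coeffs_0 [simp]: "nonneg_coeffs 0"
  by (simp add: nonneg_coeffs_def)

lemma nonneg_coeffs_1 [simp]: "nonneg_coeffs 1"
  by (simp add: nonneg_coeffs_def coeff_1)

lemma nonneg_coeffs_var_s [simp]: "nonneg_coeffs var_s"
  by (simp add: nonneg_coeffs_def var_s_def coeff_pCons split: nat.split)

lemma nonneg_coeffs_var_t [simp]: "nonneg_coeffs var_t"
  by (simp add: nonneg_coeffs_def var_t_def coeff_1)

lemma nonneg_coeffs_add [intro!]:
  "nonneg_coeffs p \<Longrightarrow> nonneg_coeffs q \<Longrightarrow> nonneg_coeffs (p + q)"
  by (simp add: nonneg_coeffs_def)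

lemma nonneg_coeffs_mult [intro!]:
  "nonneg_coeffs p \<Longrightarrow> nonneg_coeffs q \<Longrightarrow> nonneg_coeffs (p * q)"
  by (auto simp: nonneg_coeffs_def coeff_mult coeff_sum intro!: sum_nonneg)

lemma nonneg_coeffs_lucas [simp]: "nonneg_coeffs (lucas n)"
  by (induction n rule: lucas.induct) auto

lemma lucas_add:
  "lucas (m + Suc k) = lucas (Suc m) * lucas (Suc k) + var_t * lucas m * lucas k"
proof (induction k rule: lucas.induct)
  case (3 k)
  have "lucas (m + Suc (Suc (Suc k))) = var_s * lucas (m + Suc (Suc k)) + var_t * lucas (m + Suc k)"
    by simp
  also have "\<dots> = lucas (Suc m) * (var_s * lucas (Suc (Suc k)) + var_t * lucas (Suc k))
                 + var_t * lucas m * (var_s * lucas (Suc k) + var_t * lucas k)"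
    unfolding 3 by (simp only: algebra_simps)
  finally show ?case
    by (simp only: lucas.simps)
qed simp_all

text \<open>
  The quotients \<open>r\<^sub>d = {d n} / {n}\<close> satisfy \<open>r\<^sub>d\<^sub>+\<^sub>1 = {d n + 1} + t {n - 1} r\<^sub>d\<close>, the addition
  formula for \<open>d n + n\<close> divided by \<open>{n}\<close>.
\<close>

lemma lucas_mult_eq:
  "\<exists>q. nonneg_coeffs q \<and> lucas (d * n) = lucas n * q"
proof (cases n)
  case (Suc k)
  show ?thesis
  proof (induction d)
    case 0
    show ?case by (intro exI[of _ 0]) simp
  next
    case (Suc d)
    then obtain q where q: "nonneg_coeffs q" "lucas (d * n) = lucas n * q"
      by blast
    have "lucas (Suc d * n) = lucas (d * n + Suc k)"
      by (simp add: \<open>n = Suc k\<close> add_ac)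
    also have "\<dots> = lucas (Suc (d * n)) * lucas n + var_t * lucas (d * n) * lucas k"
      by (subst lucas_add) (simp add: \<open>n = Suc k\<close>)
    also have "\<dots> = lucas n * (lucas (Suc (d * n)) + var_t * lucas k * q)"
      by (simp add: q(2) algebra_simps)
    finally show ?case
      using q(1) by (intro exI[of _ "lucas (Suc (d * n)) + var_t * lucas k * q"]) auto
  qed
qed (auto intro: exI[of _ 0])

lemma lucastorial_0 [simp]: "lucastorial d 0 = 1"
  by (simp add: lucastorial_def)

lemma lucastorial_Suc: "lucastorial d (Suc n) = lucastorial d n * lucas (Suc n * d)"
  by (simp add: lucastorial_def)

text \<open>
  The cofactor is the Lucasnomial. For \<open>j, k \<ge> 1\<close>, splitting \<open>{(j + k) d}\<close> by the addition
  formula gives the Pascal-type recurrence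
  \[ {j+k:d \choose j:d} = \{jd+1\} {j+k-1:d \choose j:d} + t\,\{kd-1\} {j+k-1:d \choose j-1:d}. \]
  Stated as a product identity, it needs no division.
\<close>

lemma lucastorial_add_eq:
  assumes "d \<ge> 1"
  shows "\<exists>c. nonneg_coeffs c \<and> lucastorial d (j + k) = c * (lucastorial d j * lucastorial d k)"
proof (induction "j + k" arbitrary: j k rule: less_induct)
  case less
  show ?case
  proof (cases "j = 0 \<or> k = 0")
    case True
    then show ?thesis by (intro exI[of _ 1]) auto
  next
    case False
    then obtain a b where ab: "j = Suc a" "k = Suc b"
      by (meson not0_implies_Suc)
    obtain c1 where c1: "nonneg_coeffs c1"
      "lucastorial d (j + b) = c1 * (lucastorial d j * lucastorial d b)"
      using less[of j b] ab by auto
    obtain c2 where c2: "nonneg_coeffs c2"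
      "lucastorial d (a + k) = c2 * (lucastorial d a * lucastorial d k)"
      using less[of a k] ab by auto
    have "k * d \<noteq> 0" using ab assms by simp
    then obtain e where e: "k * d = Suc e"
      using not0_implies_Suc by blast
    have split: "lucas ((j + k) * d)
                   = lucas (Suc (j * d)) * lucas (k * d) + var_t * lucas (j * d) * lucas e"
      using lucas_add[of "j * d" e] by (simp add: e distrib_right)
    have shift: "j + b = a + k"
      by (simp add: ab)
    have Lj: "lucastorial d j = lucastorial d a * lucas (j * d)"
      and Lk: "lucastorial d k = lucastorial d b * lucas (k * d)"
      by (simp_all only: ab lucastorial_Suc)
    have "lucastorial d (j + k) = lucastorial d (j + b) * lucas ((j + k) * d)"
      using lucastorial_Suc[of d "j + b"] by (simp add: ab)
    also have "\<dots> = lucastorial d (j + b) * lucas (k * d) * lucas (Suc (j * d))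
                   + lucastorial d (a + k) * lucas (j * d) * (var_t * lucas e)"
      unfolding split shift by (simp only: algebra_simps)
    also have "\<dots> = (c1 * lucas (Suc (j * d)) + c2 * (var_t * lucas e))
                     * (lucastorial d j * lucastorial d k)"
      unfolding c1(2) c2(2) unfolding Lj Lk by (simp only: algebra_simps)
    finally show ?thesis
      using c1(1) c2(1)
      by (intro exI[of _ "c1 * lucas (Suc (j * d)) + c2 * (var_t * lucas e)"]) auto
  qed
qed

text \<open>
  The cofactor \<open>c\<close> is the central Lucasnomial. Of the two terms into which the addition formula
  splits \<open>{d m + m + 1}\<close>, only \<open>t {m}{d m}\<close> is not visibly a multiple of \<open>{m + 1}\<close>; it becomes one
  after multiplication by \<open>c\<close>, since \<open>c {d m} = c' {d (m + 1)}\<close> for the neighbouring Lucasnomial \<open>c'\<close>.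
\<close>

lemma central_lucasnomial_mult_eq:
  assumes "d \<ge> 1" and "nonneg_coeffs c"
    and c: "lucastorial d (m + m) = c * (lucastorial d m * lucastorial d m)"
  shows "\<exists>p. nonneg_coeffs p \<and> c * lucas (d * m + Suc m) = lucas (Suc m) * p"
proof -
  have "\<exists>r. nonneg_coeffs r \<and> c * lucas m * lucas (d * m) = lucas (Suc m) * r"
  proof (cases m)
    case 0
    then show ?thesis by (intro exI[of _ 0]) simp
  next
    case (Suc a)
    obtain c' where c': "nonneg_coeffs c'"
      "lucastorial d (a + Suc m) = c' * (lucastorial d a * lucastorial d (Suc m))"
      using lucastorial_add_eq[OF \<open>d \<ge> 1\<close>] by blast
    obtain q where q: "nonneg_coeffs q" "lucas (d * Suc m) = lucas (Suc m) * q"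
      using lucas_mult_eq by blast
    \<comment> \<open>Both sides are \<open>{2m:d}!\<close>, factored through \<open>(m, m)\<close> and through \<open>(m - 1, m + 1)\<close>.\<close>
    have "c * (lucastorial d m * lucastorial d m)
            = c' * (lucastorial d a * lucastorial d (Suc m))"
      unfolding c(1)[symmetric] c'(2)[symmetric] by (simp add: Suc)
    moreover have "c * (lucastorial d m * lucastorial d m)
                     = (lucastorial d a * lucastorial d m) * (c * lucas (d * m))"
      using lucastorial_Suc[of d a, folded Suc] by (simp only: mult_ac)
    moreover have "c' * (lucastorial d a * lucastorial d (Suc m))
                     = (lucastorial d a * lucastorial d m) * (c' * lucas (d * Suc m))"
      unfolding lucastorial_Suc by (simp only: mult_ac)
    ultimately have "(lucastorial d a * lucastorial d m) * (c * lucas (d * m))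
                       = (lucastorial d a * lucastorial d m) * (c' * lucas (d * Suc m))"
      by (simp only:)
    then have "c * lucas (d * m) = c' * lucas (d * Suc m)"
      using lucastorial_nonzero[OF \<open>d \<ge> 1\<close>] by (simp only: mult_cancel_left) simp
    moreover have "c * lucas m * lucas (d * m) = lucas m * (c * lucas (d * m))"
      by (simp only: mult_ac)
    ultimately have "c * lucas m * lucas (d * m) = lucas (Suc m) * (lucas m * c' * q)"
      by (simp only: q(2) mult_ac)
    then show ?thesis
      using c'(1) q(1) by (intro exI[of _ "lucas m * c' * q"]) auto
  qed
  then obtain r where r: "nonneg_coeffs r"
      "c * lucas m * lucas (d * m) = lucas (Suc m) * r"
    by blast
  have "c * lucas (d * m + Suc m)
          = c * lucas (Suc (d * m)) * lucas (Suc m) + var_t * (c * lucas m * lucas (d * m))"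
    unfolding lucas_add by (simp only: algebra_simps)
  also have "\<dots> = lucas (Suc m) * (c * lucas (Suc (d * m)) + var_t * r)"
    unfolding r(2) by (simp only: algebra_simps)
  finally show ?thesis
    using r(1) \<open>nonneg_coeffs c\<close>
    by (intro exI[of _ "c * lucas (Suc (d * m)) + var_t * r"]) auto
qed

theorem theorem5p4:
  fixes d n :: nat
  assumes "d \<ge> 1" and "n \<ge> 1"
  shows "to_fract (lucas ((d + 1) * n - d)) / to_fract (lucas n)
           * lucasnomial d (2 * (n - 1)) (n - 1) \<in> nat_polys"
proof -
  obtain m where n: "n = Suc m" using \<open>n \<ge> 1\<close> by (cases n) auto
  obtain c where c: "nonneg_coeffs c"
      "lucastorial d (m + m) = c * (lucastorial d m * lucastorial d m)"
    using lucastorial_add_eq[OF \<open>d \<ge> 1\<close>] by blast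
  obtain p where p: "nonneg_coeffs p" "c * lucas (d * m + Suc m) = lucas (Suc m) * p"
    using central_lucasnomial_mult_eq[OF \<open>d \<ge> 1\<close> c] by blast
  have index: "(d + 1) * n - d = d * m + Suc m"
    by (simp add: n)
  have "lucasnomial d (2 * (n - 1)) (n - 1) = to_fract c"
    using lucastorial_nonzero[OF \<open>d \<ge> 1\<close>, of m]
    by (simp add: lucasnomial_def n mult_2 c(2))
  then have "to_fract (lucas ((d + 1) * n - d)) / to_fract (lucas n)
               * lucasnomial d (2 * (n - 1)) (n - 1)
             = to_fract (c * lucas (d * m + Suc m)) / to_fract (lucas (Suc m))"
    unfolding index unfolding n by (simp only: to_fract_mult mult.commute times_divide_eq_right)
  also have "\<dots> = to_fract p"
    unfolding p(2) using lucas_nonzero[of "Suc m"] by (simp del: lucas.simps)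
  finally show ?thesis
    using p(1) by (auto simp: nat_polys_def nonneg_coeffs_def)
qed

end
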